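(* Let $\Omega\subset\mathbb{R}^n$ be a nonempty unbounded convex set, and let $A:\mathbb{R}^n\to\mathbb{R}^m$ be linear. Fix nonempty index sets $I\subset\{1,\dots,n\}$ and $J\subset\{1,\dots,m\}$. Assume that $\pi_J(A(\Omega))$ is unbounded and that for every sequence $\{x_k\}$, $$x_k\in\Omega,\ \|\pi_J(Ax_k)\|\to\infty\ \Longrightarrow\ \|\pi_I(x_k)\|\to\infty.$$ Then: (i) if $v\in T(\infty_I;\Omega)$, then $Av\in T(\infty_J;A(\Omega))$; (ii) if $w\in N(\infty_J;A(\Omega))$, then $A^\top w\in N(\infty_I;\Omega)$; (iii) if, in addition, $m=n$, $A$ is invertible, and for every sequence $\{x_k\}$, $$x_k\in\Omega,\ \|\pi_I(x_k)\|\to\infty\ \Longrightarrow\ \|\pi_J(Ax_k)\|\to\infty,$$ then the converses of (i) and (ii) also hold; equivalently, $$A\bigl(T(\infty_I;\Omega)\bigr)=T(\infty_J;A(\Omega))\quad\text{and}\quad A^\top N(\infty_J;A(\Omega))=N(\infty_I;\Omega).$$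
   Context: Euclidean inner products and norms are used. For a nonempty index set $I\subset\{1,\dots,p\}$, $\pi_I:\mathbb{R}^p\to\mathbb{R}^{|I|}$ is $\pi_I(x)=(x_i)_{i\in I}$. For a nonempty convex set $\Omega\subset\mathbb{R}^p$, the tangent cone at infinity $T(\infty_I;\Omega)$ is the set of $w\in\mathbb{R}^p$ such that for all sequences $x_k\in\Omega$ with $\|\pi_I(x_k)\|\to\infty$ and all $t_k>0$ with $t_k\to 0$ there exist $w_k\to w$ with $x_k+t_kw_k\in\Omega$ for all $k$. The normal cone at infinity is $N(\infty_I;\Omega)=\{v\mid\langle v,w\rangle\le 0\ \forall w\in T(\infty_I;\Omega)\}$. *)

theory Defs
  imports "HOL-Analysis.Analysis"
begin

text \<open>
  The target of the coordinate projection \<open>\<pi>\<^sub>I\<close> is realised inside the ambient space: the coordinates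
  outside \<open>I\<close> are set to zero. This is the isometric copy of the space of dimension \<open>card I\<close>
  given by extension by zero, so norms and boundedness are those of \<open>(x\<^sub>i)\<^sub>i\<^sub>\<in>\<^sub>I\<close>.
\<close>

definition coord_proj :: "'p set \<Rightarrow> real ^ 'p \<Rightarrow> real ^ ('p::finite)" where
  "coord_proj I x = (\<chi> i. if i \<in> I then x $ i else 0)"

lemma norm_coord_proj: "norm (coord_proj I x) = sqrt (\<Sum>i\<in>I. (x $ i)\<^sup>2)"
proof -
  have "(\<Sum>i\<in>UNIV. (coord_proj I x $ i)\<^sup>2) = (\<Sum>i\<in>I. (coord_proj I x $ i)\<^sup>2)"
    by (rule sum.mono_neutral_right) (auto simp: coord_proj_def)
  then show ?thesis
    by (simp add: norm_vec_def L2_set_def coord_proj_def)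
qed

definition tangent_cone_infinity :: "'p set \<Rightarrow> (real ^ 'p) set \<Rightarrow> (real ^ ('p::finite)) set" where
  "tangent_cone_infinity I \<Omega> =
    {w. \<forall>x t. (\<forall>k. x k \<in> \<Omega>) \<longrightarrow> filterlim (\<lambda>k. norm (coord_proj I (x k))) at_top sequentially \<longrightarrow>
          (\<forall>k::nat. t k > 0) \<longrightarrow> t \<longlonglongrightarrow> (0::real) \<longrightarrow>
          (\<exists>u. u \<longlonglongrightarrow> w \<and> (\<forall>k. x k + t k *\<^sub>R u k \<in> \<Omega>))}"

definition normal_cone_infinity :: "'p set \<Rightarrow> (real ^ 'p) set \<Rightarrow> (real ^ ('p::finite)) set" where
  "normal_cone_infinity I \<Omega> = {v. \<forall>w \<in> tangent_cone_infinity I \<Omega>. v \<bullet> w \<le> 0}"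

end

theory Submission
  imports Defs
begin

text \<open>A linear map carries a perturbation \<open>x k + t k *\<^sub>R u k\<close> inside
  \<Omega> to a perturbation of \<open>A (x k)\<close> with the same step \<open>t k\<close> and
  direction \<open>A (u k)\<close>, and continuity turns \<open>u k\<close> tending to v into
  \<open>A (u k)\<close> tending to \<open>A v\<close>. The growth condition is what makes a
  sequence escaping in the J-coordinates of the image come from one escaping in the I-coordinates of
  \<Omega>, where the tangency of v can be used. This gives (i), and (ii) follows by duality through
  \<open>adjoint_normal_cone_infinity\<close>. For (iii) both lemmas are applied again to the
  inverse of \<open>A\<close>, with the roles of I and J exchanged. Hence they are stated for an
  arbitrary linear map between possibly different spaces.\<close>

lemma tangent_cone_infinity_linear_image:
  fixes A :: "real ^ 'n::finite \<Rightarrow> real ^ 'm::finite"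
  assumes A: "linear A"
    and growth: "\<And>x :: nat \<Rightarrow> real ^ 'n. (\<forall>k. x k \<in> \<Omega>) \<Longrightarrow>
           filterlim (\<lambda>k. norm (coord_proj J (A (x k)))) at_top sequentially \<Longrightarrow>
           filterlim (\<lambda>k. norm (coord_proj I (x k))) at_top sequentially"
    and v: "v \<in> tangent_cone_infinity I \<Omega>"
  shows "A v \<in> tangent_cone_infinity J (A ` \<Omega>)"
  unfolding tangent_cone_infinity_def
proof (intro CollectI allI impI)
  fix y t
  assume y: "\<forall>k. y k \<in> A ` \<Omega>"
    and y_lim: "filterlim (\<lambda>k. norm (coord_proj J (y k))) at_top sequentially"
    and t: "\<forall>k::nat. t k > 0" "t \<longlonglongrightarrow> (0::real)"
  \<comment> \<open>Any choice of preimages in \<Omega> will do, since the growth condition speaks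
    about every sequence in \<Omega>.\<close>
  from y have "\<forall>k. \<exists>x. x \<in> \<Omega> \<and> y k = A x"
    by blast
  then obtain x where x: "\<forall>k. x k \<in> \<Omega>" and y_eq: "\<And>k. y k = A (x k)"
    by metis
  have "filterlim (\<lambda>k. norm (coord_proj I (x k))) at_top sequentially"
    using growth[OF x] y_lim by (simp add: y_eq)
  with v x t obtain u where u: "u \<longlonglongrightarrow> v" "\<forall>k. x k + t k *\<^sub>R u k \<in> \<Omega>"
    unfolding tangent_cone_infinity_def by blast
  have "(\<lambda>k. A (u k)) \<longlonglongrightarrow> A v"
    using A u(1) by (simp add: linear_conv_bounded_linear bounded_linear.tendsto)
  moreover have "y k + t k *\<^sub>R A (u k) \<in> A ` \<Omega>" for k
  proof -
    have "y k + t k *\<^sub>R A (u k) = A (x k + t k *\<^sub>R u k)"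
      by (simp add: y_eq linear_add[OF A] linear_scale[OF A])
    with u(2) show ?thesis by blast
  qed
  ultimately show "\<exists>u. u \<longlonglongrightarrow> A v \<and> (\<forall>k. y k + t k *\<^sub>R u k \<in> A ` \<Omega>)"
    by blast
qed

text \<open>Pure polarity: the inner product of \<open>adjoint A w\<close> with a tangent vector v
  equals that of w with \<open>A v\<close>, which is at most 0 because \<open>A v\<close> is again
  tangent.\<close>

lemma adjoint_normal_cone_infinity:
  fixes A :: "real ^ 'n::finite \<Rightarrow> real ^ 'm::finite"
  assumes "linear A"
    and "A ` tangent_cone_infinity I \<Omega> \<subseteq> tangent_cone_infinity J \<Omega>'"
    and "w \<in> normal_cone_infinity J \<Omega>'"
  shows "adjoint A w \<in> normal_cone_infinity I \<Omega>"
  using assms by (auto simp: normal_cone_infinity_def adjoint_clauses)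

theorem proposition3p23:
  fixes \<Omega> :: "(real ^ 'n::finite) set"
    and A :: "real ^ 'n \<Rightarrow> real ^ 'm::finite"
    and I :: "'n set" and J :: "'m set"
  assumes "\<Omega> \<noteq> {}" and "\<not> bounded \<Omega>" and "convex \<Omega>"
    and "linear A"
    and "I \<noteq> {}" and "J \<noteq> {}"
    and "\<not> bounded (coord_proj J ` A ` \<Omega>)"
    and "\<And>x :: nat \<Rightarrow> real ^ 'n. (\<forall>k. x k \<in> \<Omega>) \<Longrightarrow>
           filterlim (\<lambda>k. norm (coord_proj J (A (x k)))) at_top sequentially \<Longrightarrow>
           filterlim (\<lambda>k. norm (coord_proj I (x k))) at_top sequentially"
  shows "(\<forall>v. v \<in> tangent_cone_infinity I \<Omega> \<longrightarrow> A v \<in> tangent_cone_infinity J (A ` \<Omega>))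
    \<and> (\<forall>w. w \<in> normal_cone_infinity J (A ` \<Omega>) \<longrightarrow> adjoint A w \<in> normal_cone_infinity I \<Omega>)
    \<and> (CARD('m) = CARD('n) \<and> bij A \<and>
        (\<forall>x :: nat \<Rightarrow> real ^ 'n. (\<forall>k. x k \<in> \<Omega>) \<longrightarrow>
           filterlim (\<lambda>k. norm (coord_proj I (x k))) at_top sequentially \<longrightarrow>
           filterlim (\<lambda>k. norm (coord_proj J (A (x k)))) at_top sequentially)
       \<longrightarrow> (\<forall>v. A v \<in> tangent_cone_infinity J (A ` \<Omega>) \<longrightarrow> v \<in> tangent_cone_infinity I \<Omega>)
         \<and> (\<forall>w. adjoint A w \<in> normal_cone_infinity I \<Omega> \<longrightarrow> w \<in> normal_cone_infinity J (A ` \<Omega>))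
         \<and> A ` tangent_cone_infinity I \<Omega> = tangent_cone_infinity J (A ` \<Omega>)
         \<and> adjoint A ` normal_cone_infinity J (A ` \<Omega>) = normal_cone_infinity I \<Omega>)"
proof -
  let ?TI = "tangent_cone_infinity I \<Omega>" and ?TJ = "tangent_cone_infinity J (A ` \<Omega>)"
  let ?NI = "normal_cone_infinity I \<Omega>" and ?NJ = "normal_cone_infinity J (A ` \<Omega>)"
  note A = \<open>linear A\<close>
  have T: "A v \<in> ?TJ" if "v \<in> ?TI" for v
    using tangent_cone_infinity_linear_image[OF A _ that] assms(8) by blast
  have N: "adjoint A w \<in> ?NI" if "w \<in> ?NJ" for w
    using adjoint_normal_cone_infinity[OF A _ that] T by blast
  have "(\<forall>v. A v \<in> ?TJ \<longrightarrow> v \<in> ?TI) \<and> (\<forall>w. adjoint A w \<in> ?NI \<longrightarrow> w \<in> ?NJ)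
      \<and> A ` ?TI = ?TJ \<and> adjoint A ` ?NJ = ?NI"
    if "bij A"
      and growth: "\<forall>x :: nat \<Rightarrow> real ^ 'n. (\<forall>k. x k \<in> \<Omega>) \<longrightarrow>
           filterlim (\<lambda>k. norm (coord_proj I (x k))) at_top sequentially \<longrightarrow>
           filterlim (\<lambda>k. norm (coord_proj J (A (x k)))) at_top sequentially"
  proof -
    define B where "B = inv A"
    have BA: "B (A x) = x" and AB: "A (B y) = y" for x y
      using \<open>bij A\<close> by (auto simp: B_def bij_def surj_f_inv_f)
    have B: "linear B"
    proof (rule linearI)
      show "B (x + y) = B x + B y" for x y
        by (metis A AB BA linear_add)
      show "B (c *\<^sub>R x) = c *\<^sub>R B x" for c x
        by (metis A AB BA linear_scale)
    qed
    have BA_image: "B ` A ` \<Omega> = \<Omega>"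
      by (simp add: image_image BA)
    \<comment> \<open>The extra assumption of (iii), rewritten along x = \<open>B y\<close>, is
      exactly the growth condition that the image lemma demands of \<open>B\<close>.\<close>
    have growth_B: "filterlim (\<lambda>k. norm (coord_proj J (y k))) at_top sequentially"
      if y: "\<forall>k. y k \<in> A ` \<Omega>"
        and lim: "filterlim (\<lambda>k. norm (coord_proj I (B (y k)))) at_top sequentially"
      for y :: "nat \<Rightarrow> real ^ 'm"
    proof -
      have "\<forall>k. B (y k) \<in> \<Omega>"
        using y BA_image by blast
      with growth[rule_format, of "\<lambda>k. B (y k)"] lim show ?thesis
        by (simp add: AB)
    qed
    have TB: "B z \<in> ?TI" if "z \<in> ?TJ" for z
      using tangent_cone_infinity_linear_image[OF B growth_B that] by (simp add: BA_image)
    have NB: "adjoint B u \<in> ?NJ" if "u \<in> ?NI" for u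
      using adjoint_normal_cone_infinity[OF B _ that] TB by blast
    \<comment> \<open>Tested against an arbitrary vector z, both adjoints move across the inner
      product and leave \<open>B (A z)\<close>, which is z.\<close>
    have adj_AB: "adjoint A (adjoint B u) = u" for u
      by (rule vector_eq_rdot[THEN iffD1]) (simp add: adjoint_clauses A B BA)
    have adj_BA: "adjoint B (adjoint A w) = w" for w
      by (rule vector_eq_rdot[THEN iffD1]) (simp add: adjoint_clauses A B AB)
    show ?thesis
    proof (intro conjI allI impI)
      show "v \<in> ?TI" if "A v \<in> ?TJ" for v
        using TB[OF that] by (simp add: BA)
      show "w \<in> ?NJ" if "adjoint A w \<in> ?NI" for w
        using NB[OF that] by (simp add: adj_BA)
      \<comment> \<open>Surjectivity is the point: z is the image of \<open>B z\<close>, tangent by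
        \<open>TB\<close>. For the normal cones the preimage of u is
        \<open>adjoint B u\<close>.\<close>
      show "A ` ?TI = ?TJ"
        using T TB by (force simp: AB intro: image_eqI[where x = "B _"])
      show "adjoint A ` ?NJ = ?NI"
        using N NB by (force simp: adj_AB intro: image_eqI[where x = "adjoint B _"])
    qed
  qed
  with T N show ?thesis by blast
qed

end
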